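(* There exists a recurrent and recursive bi-infinite word $\xi$ whose set of factors $F(\xi)$ is decidable, but whose MSO-theory $\mathsf{MTh}(\xi)$ is undecidable.
   Context: A bi-infinite word is a map $\xi\colon\mathbb Z\to\{0,1\}$, viewed as the structure $(\mathbb Z,\le,\xi^{-1}(1))$; $\mathsf{MTh}(\xi)$ is the set of monadic second-order sentences over $\{\le,P\}$ true in it. For $i\le j$, $\xi[i,j]=\xi(i)\cdots\xi(j)$; $F(\xi)$ is the set of all $\xi[i,j]$ ($i\le j$) plus the empty word. $\xi$ is recurrent if $F(\xi)=F(\xi(-\infty,i])=F(\xi[i,\infty))$ for all $i\in\mathbb Z$, where $\xi(-\infty,i]$ and $\xi[i,\infty)$ are the left- and right-infinite halves with analogously defined factor sets. $\xi$ is recursive if $\{2i\mid i\ge0,\xi(i)=1\}\cup\{2i+1\mid i>0,\xi(-i)=1\}$ is recursive; sets of finite words are identified with subsets of $\mathbb N$ via a fixed effective enumeration of $\{0,1\}^*$. *)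

theory Defs
  imports Main "HOL-Library.Nat_Bijection"
begin

section \<open>Bi-infinite words and their factors\<close>

text \<open>The letters 0 and 1 are rendered as \<^const>\<open>False\<close> and \<^const>\<open>True\<close>.\<close>

type_synonym biword = "int \<Rightarrow> bool"

definition segment :: "biword \<Rightarrow> int \<Rightarrow> int \<Rightarrow> bool list" where
  "segment \<xi> i j = map \<xi> [i..j]"

text \<open>\<open>factors_on \<xi> I\<close> is the factor set of the restriction of \<open>\<xi>\<close> to the interval \<open>I\<close>:
  \<^term>\<open>UNIV\<close> gives the whole word, \<open>{..i}\<close> the left-infinite half \<open>\<xi>(-\<infinity>,i]\<close>, and
  \<open>{i..}\<close> the right-infinite half \<open>\<xi>[i,\<infinity>)\<close>.\<close>

definition factors_on :: "biword \<Rightarrow> int set \<Rightarrow> bool list set" where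
  "factors_on \<xi> I = {segment \<xi> i j | i j. i \<le> j \<and> {i..j} \<subseteq> I} \<union> {[]}"

abbreviation factors :: "biword \<Rightarrow> bool list set" where
  "factors \<xi> \<equiv> factors_on \<xi> UNIV"

definition recurrent :: "biword \<Rightarrow> bool" where
  "recurrent \<xi> \<longleftrightarrow>
     (\<forall>i. factors \<xi> = factors_on \<xi> {..i} \<and> factors_on \<xi> {..i} = factors_on \<xi> {i..})"


section \<open>Recursive sets of natural numbers\<close>

datatype recf =
    Zero
  | Succ
  | Proj nat
  | Comp recf "recf list"
  | PrimRec recf recf
  | Mu recf

text \<open>Big-step semantics of partial (mu-)recursive functions: \<open>evals f xs y\<close> means that \<open>f\<close>
  is defined on the argument tuple \<open>xs\<close> with value \<open>y\<close>. Projections count from 0. The recursion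
  argument of \<^const>\<open>PrimRec\<close> and the search variable of \<^const>\<open>Mu\<close> come first, and
  minimization requires all smaller arguments to yield a defined, nonzero value.\<close>

inductive evals :: "recf \<Rightarrow> nat list \<Rightarrow> nat \<Rightarrow> bool" where
  Zero: "evals Zero xs 0"
| Succ: "evals Succ [x] (Suc x)"
| Proj: "i < length xs \<Longrightarrow> evals (Proj i) xs (xs ! i)"
| Comp: "list_all2 (\<lambda>g y. evals g xs y) gs ys \<Longrightarrow> evals f ys z \<Longrightarrow> evals (Comp f gs) xs z"
| PrimRec_0: "evals f xs y \<Longrightarrow> evals (PrimRec f g) (0 # xs) y"
| PrimRec_Suc: "evals (PrimRec f g) (n # xs) r \<Longrightarrow> evals g (r # n # xs) y \<Longrightarrow>
    evals (PrimRec f g) (Suc n # xs) y"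
| Mu: "evals f (n # xs) 0 \<Longrightarrow> \<forall>i<n. \<exists>y. evals f (i # xs) (Suc y) \<Longrightarrow> evals (Mu f) xs n"

inductive_cases ZeroE: "evals Zero xs y"
inductive_cases SuccE: "evals Succ xs y"
inductive_cases ProjE: "evals (Proj i) xs y"
inductive_cases CompE: "evals (Comp f gs) xs y"
inductive_cases PrimRec_0E: "evals (PrimRec f g) (0 # xs) y"
inductive_cases PrimRec_SucE: "evals (PrimRec f g) (Suc n # xs) y"
inductive_cases MuE: "evals (Mu f) xs y"

lemma evals_deterministic: "evals f xs y \<Longrightarrow> evals f xs z \<Longrightarrow> y = z"
proof (induction f xs y arbitrary: z rule: evals.induct)
  case (Zero xs) then show ?case by (blast elim: ZeroE)
next
  case (Succ x) then show ?case by (blast elim: SuccE)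
next
  case (Proj i xs) then show ?case by (blast elim: ProjE)
next
  case (Comp xs gs ys f y)
  from Comp.prems obtain ys' where ys': "list_all2 (\<lambda>g y. evals g xs y) gs ys'" "evals f ys' z"
    by (rule CompE)
  have "ys = ys'"
    using Comp.IH(1) ys'(1) by (simp add: list_all2_conv_all_nth list_eq_iff_nth_eq)
  with Comp.IH(2) ys'(2) show ?case by blast
next
  case (PrimRec_0 f xs y g) then show ?case by (blast elim: PrimRec_0E)
next
  case (PrimRec_Suc f g n xs r y)
  from PrimRec_Suc.prems obtain r' where r': "evals (PrimRec f g) (n # xs) r'"
      "evals g (r' # n # xs) z"
    by (rule PrimRec_SucE)
  have "r = r'" using PrimRec_Suc.IH(1) r'(1) by blast
  with PrimRec_Suc.IH(2) r'(2) show ?case by blast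
next
  case (Mu f n xs)
  from Mu.prems have z: "evals f (z # xs) 0" "\<forall>i<z. \<exists>y. evals f (i # xs) (Suc y)"
    by (blast elim: MuE)+
  have "\<not> z < n" using Mu.IH(2) z(1) by blast
  moreover have "\<not> n < z" using Mu.IH(1) z(2) by blast
  ultimately show ?case by simp
qed

definition recursive_set :: "nat set \<Rightarrow> bool" where
  "recursive_set A \<longleftrightarrow> (\<exists>f. \<forall>n. evals f [n] (if n \<in> A then 1 else 0))"

definition recursive_word :: "biword \<Rightarrow> bool" where
  "recursive_word \<xi> \<longleftrightarrow>
     recursive_set ({2 * i | i. \<xi> (int i)} \<union> {2 * i + 1 | i. i > 0 \<and> \<xi> (- int i)})"

text \<open>The effective enumeration of finite words is bijective base-2 notation, with the first
  letter least significant.\<close>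

fun word_code :: "bool list \<Rightarrow> nat" where
  "word_code [] = 0"
| "word_code (b # w) = 2 * word_code w + (if b then 2 else 1)"

lemma bij_word_code: "bij word_code"
proof (rule bijI)
  show "inj word_code"
  proof (rule injI)
    fix v w show "word_code v = word_code w \<Longrightarrow> v = w"
    proof (induction v arbitrary: w)
      case Nil then show ?case by (cases w) (auto split: if_splits)
    next
      case (Cons b v)
      then obtain c u where w: "w = c # u" by (cases w) (auto split: if_splits)
      from Cons.prems have "b = c \<and> word_code v = word_code u"
        unfolding w by (simp split: if_splits; presburger)
      with Cons.IH w show ?case by blast
    qed
  qed
  have "\<exists>w. word_code w = n" for n
  proof (induction n rule: less_induct)
    case (less n)
    show ?case
    proof (cases "n = 0")
      case True then show ?thesis by (metis word_code.simps(1))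
    next
      case False
      then obtain w where w: "word_code w = (n - 1) div 2"
        using less.IH[of "(n - 1) div 2"] by (metis One_nat_def diff_less div_le_dividend le_less_trans neq0_conv zero_less_one)
      have "word_code (even n # w) = n"
        using False unfolding word_code.simps w by (cases "even n") (auto elim!: evenE oddE)
      then show ?thesis by blast
    qed
  qed
  then show "surj word_code" by (metis surjI)
qed

definition decidable_language :: "bool list set \<Rightarrow> bool" where
  "decidable_language L \<longleftrightarrow> recursive_set (word_code ` L)"


section \<open>Monadic second-order logic over one binary and one unary relation\<close>

text \<open>First-order and set variables are separate sorts, both named by natural numbers.
  \<open>LessEq x y\<close>, \<open>Equal x y\<close>, \<open>Label x\<close> and \<open>Elem x X\<close> are the atomic formulas
  \<open>x \<le> y\<close>, \<open>x = y\<close>, \<open>P(x)\<close> and \<open>x \<in> X\<close>.\<close>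

datatype mso =
    LessEq nat nat
  | Equal nat nat
  | Label nat
  | Elem nat nat
  | Neg mso
  | Disj mso mso
  | ExElt nat mso
  | ExSet nat mso

fun free_elts :: "mso \<Rightarrow> nat set" where
  "free_elts (LessEq x y) = {x, y}"
| "free_elts (Equal x y) = {x, y}"
| "free_elts (Label x) = {x}"
| "free_elts (Elem x X) = {x}"
| "free_elts (Neg \<phi>) = free_elts \<phi>"
| "free_elts (Disj \<phi> \<psi>) = free_elts \<phi> \<union> free_elts \<psi>"
| "free_elts (ExElt x \<phi>) = free_elts \<phi> - {x}"
| "free_elts (ExSet X \<phi>) = free_elts \<phi>"

fun free_sets :: "mso \<Rightarrow> nat set" where
  "free_sets (LessEq x y) = {}"
| "free_sets (Equal x y) = {}"
| "free_sets (Label x) = {}"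
| "free_sets (Elem x X) = {X}"
| "free_sets (Neg \<phi>) = free_sets \<phi>"
| "free_sets (Disj \<phi> \<psi>) = free_sets \<phi> \<union> free_sets \<psi>"
| "free_sets (ExElt x \<phi>) = free_sets \<phi>"
| "free_sets (ExSet X \<phi>) = free_sets \<phi> - {X}"

definition sentence :: "mso \<Rightarrow> bool" where
  "sentence \<phi> \<longleftrightarrow> free_elts \<phi> = {} \<and> free_sets \<phi> = {}"

text \<open>Satisfaction in the structure with universe \<^typ>\<open>'a\<close>, binary relation \<open>le\<close> and unary
  relation \<open>P\<close>, under the assignments \<open>s\<close> to first-order and \<open>S\<close> to set variables.\<close>

fun sat :: "('a \<Rightarrow> 'a \<Rightarrow> bool) \<Rightarrow> 'a set \<Rightarrow> (nat \<Rightarrow> 'a) \<Rightarrow> (nat \<Rightarrow> 'a set) \<Rightarrow> mso \<Rightarrow> bool" where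
  "sat le P s S (LessEq x y) \<longleftrightarrow> le (s x) (s y)"
| "sat le P s S (Equal x y) \<longleftrightarrow> s x = s y"
| "sat le P s S (Label x) \<longleftrightarrow> s x \<in> P"
| "sat le P s S (Elem x X) \<longleftrightarrow> s x \<in> S X"
| "sat le P s S (Neg \<phi>) \<longleftrightarrow> \<not> sat le P s S \<phi>"
| "sat le P s S (Disj \<phi> \<psi>) \<longleftrightarrow> sat le P s S \<phi> \<or> sat le P s S \<psi>"
| "sat le P s S (ExElt x \<phi>) \<longleftrightarrow> (\<exists>a. sat le P (s(x := a)) S \<phi>)"
| "sat le P s S (ExSet X \<phi>) \<longleftrightarrow> (\<exists>A. sat le P s (S(X := A)) \<phi>)"

definition MTh :: "biword \<Rightarrow> mso set" where
  "MTh \<xi> = {\<phi>. sentence \<phi> \<and> (\<forall>s S. sat (\<le>) {i. \<xi> i} s S \<phi>)}"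

fun mso_code :: "mso \<Rightarrow> nat" where
  "mso_code (LessEq x y) = prod_encode (0, prod_encode (x, y))"
| "mso_code (Equal x y) = prod_encode (1, prod_encode (x, y))"
| "mso_code (Label x) = prod_encode (2, x)"
| "mso_code (Elem x X) = prod_encode (3, prod_encode (x, X))"
| "mso_code (Neg \<phi>) = prod_encode (4, mso_code \<phi>)"
| "mso_code (Disj \<phi> \<psi>) = prod_encode (5, prod_encode (mso_code \<phi>, mso_code \<psi>))"
| "mso_code (ExElt x \<phi>) = prod_encode (6, prod_encode (x, mso_code \<phi>))"
| "mso_code (ExSet X \<phi>) = prod_encode (7, prod_encode (X, mso_code \<phi>))"

lemma inj_mso_code: "inj mso_code"
proof (rule injI)
  fix \<phi> \<psi> show "mso_code \<phi> = mso_code \<psi> \<Longrightarrow> \<phi> = \<psi>"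
    by (induction \<phi> arbitrary: \<psi>; case_tac \<psi>) auto
qed

definition decidable_theory :: "mso set \<Rightarrow> bool" where
  "decidable_theory T \<longleftrightarrow> recursive_set (mso_code ` T)"

end

(* Let T be a decidable relation such that {n. EX m. T n m} is undecidable. Call a finite word legal if
   it contains the pattern 1 1 0^(m+1) 1 0^(n+1) 1 1 only when T n m holds; legality is decidable. Two legal
   words joined by 01010 remain legal, because the pattern has a single isolated 1 in its interior.
   Hence concatenating all legal words, each infinitely often in both directions, gives a recurrent
   recursive word whose factors are the legal words. The first-order sentence "for some m the pattern
   occurs with parameter n" holds in it iff EX m. T n m, so the theory is undecidable.

   T is obtained from the inductive definition of evals: "m bounds the stage by which the function
   with code n, applied to n, is derived to have value 0". Its projection is undecidable by
   diagonalization. *)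

theory Submission
  imports Defs
begin

section \<open>Computable functions and decidable predicates\<close>

text \<open>An occurrence of the whole pattern in a finite word shows both parameters in unary, so
  testing that word only queries \<open>T\<close>. The sentence for \<open>n\<close> leaves
  \<open>m\<close> to quantification over positions, where no computable bound is available; this
  gap separates the theory from the factors. For \<open>T\<close>, neither a universal function nor
  derivation trees are coded. The relation \<open>evals\<close> is approximated from below by finite
  sets of judgements, each set being one number, so that a single primitive recursion produces all
  of them. After a bootstrap with two and three arguments, computability is treated for unary
  functions only, further arguments being packed by Cantor's pairing. The same pairing later lays
  out the word: its diagonals are the blocks.\<close>

definition computable :: "(nat \<Rightarrow> nat) \<Rightarrow> bool" where
  "computable F \<longleftrightarrow> (\<exists>f. \<forall>n. evals f [n] (F n))"

definition computable2 :: "(nat \<Rightarrow> nat \<Rightarrow> nat) \<Rightarrow> bool" where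
  "computable2 F \<longleftrightarrow> (\<exists>f. \<forall>m n. evals f [m, n] (F m n))"

definition computable3 :: "(nat \<Rightarrow> nat \<Rightarrow> nat \<Rightarrow> nat) \<Rightarrow> bool" where
  "computable3 F \<longleftrightarrow> (\<exists>f. \<forall>l m n. evals f [l, m, n] (F l m n))"

lemma evals_Proj: "i < length xs \<Longrightarrow> y = xs ! i \<Longrightarrow> evals (Proj i) xs y"
  by (simp add: evals.Proj)

lemma evals_Comp1: "evals g xs a \<Longrightarrow> evals f [a] y \<Longrightarrow> evals (Comp f [g]) xs y"
  by (rule evals.Comp[where ys = "[a]"]) auto

lemma evals_Comp2:
  "evals g xs a \<Longrightarrow> evals h xs b \<Longrightarrow> evals f [a, b] y \<Longrightarrow> evals (Comp f [g, h]) xs y"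
  by (rule evals.Comp[where ys = "[a, b]"]) auto

lemma evals_PrimRec:
  assumes "evals f xs a" "\<And>i r. evals g (r # i # xs) (H i r)"
  shows "evals (PrimRec f g) (n # xs) (rec_nat a H n)"
  by (induction n) (auto intro: evals.PrimRec_0 evals.PrimRec_Suc assms)

lemma computable_id: "computable (\<lambda>n. n)"
  unfolding computable_def by (rule exI[of _ "Proj 0"]) (simp add: evals_Proj)

lemma computable_const: "computable (\<lambda>_. c)"
  unfolding computable_def
proof (induction c)
  case 0
  show ?case by (rule exI[of _ Zero]) (simp add: evals.Zero)
next
  case (Suc c)
  then obtain f where "\<forall>n. evals f [n] c" by blast
  then show ?case by (intro exI[of _ "Comp Succ [f]"]) (auto intro: evals_Comp1 evals.Succ)
qed

lemma computable_comp: "computable F \<Longrightarrow> computable G \<Longrightarrow> computable (\<lambda>n. F (G n))"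
  unfolding computable_def
  by (elim exE, rule_tac x = "Comp f [fa]" in exI) (intro allI evals_Comp1; blast)

lemma computable_comp2:
  "computable2 F \<Longrightarrow> computable G \<Longrightarrow> computable H \<Longrightarrow> computable (\<lambda>n. F (G n) (H n))"
  unfolding computable_def computable2_def
  by (elim exE, rule_tac x = "Comp f [fa, fb]" in exI) (intro allI evals_Comp2; blast)

lemma computable2_const: "computable2 (\<lambda>_ _. c)"
proof -
  obtain f where "\<forall>n. evals f [n] c" using computable_const computable_def by metis
  then show ?thesis unfolding computable2_def
    by (intro exI[of _ "Comp f [Proj 0]"]) (auto intro: evals_Comp1 evals_Proj)
qed

lemma computable2_fst: "computable2 (\<lambda>m n. m)"
  and computable2_snd: "computable2 (\<lambda>m n. n)"
  unfolding computable2_def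
  subgoal by (rule exI[of _ "Proj 0"]) (simp add: evals_Proj)
  subgoal by (rule exI[of _ "Proj 1"]) (simp add: evals_Proj)
  done

lemma computable2_comp: "computable F \<Longrightarrow> computable2 G \<Longrightarrow> computable2 (\<lambda>m n. F (G m n))"
  unfolding computable_def computable2_def
  by (elim exE, rule_tac x = "Comp f [fa]" in exI) (intro allI evals_Comp1; blast)

lemma computable2_comp2:
  "computable2 F \<Longrightarrow> computable2 G \<Longrightarrow> computable2 H \<Longrightarrow> computable2 (\<lambda>m n. F (G m n) (H m n))"
  unfolding computable2_def
  by (elim exE, rule_tac x = "Comp f [fa, fb]" in exI) (intro allI evals_Comp2; blast)

lemma computable2_rec_nat:
  assumes "computable A" "computable3 H"
  shows "computable2 (\<lambda>n x. rec_nat (A x) (\<lambda>i r. H r i x) n)"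
proof -
  obtain a h where a: "\<forall>n. evals a [n] (A n)" and h: "\<forall>l m n. evals h [l, m, n] (H l m n)"
    using assms unfolding computable_def computable3_def by blast
  show ?thesis unfolding computable2_def
    by (intro exI[of _ "PrimRec a h"] allI evals_PrimRec) (use a h in auto)
qed

lemma computable_rec_nat_closed:
  assumes "computable2 H"
  shows "computable (rec_nat a (\<lambda>i r. H r i))"
proof -
  obtain h where h: "\<forall>m n. evals h [m, n] (H m n)" using assms unfolding computable2_def by blast
  obtain f where f: "\<forall>n. evals f [n] a" using computable_const computable_def by metis
  \<comment> \<open>\<open>PrimRec\<close> passes the remaining arguments to its base function, and
    \<open>f\<close> is available on one-element lists; duplicating the argument fills that
    slot.\<close>
  have z: "evals (Comp (PrimRec f (Comp h [Proj 0, Proj 1])) [Proj 0, Proj 0]) [n]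
      (rec_nat a (\<lambda>i r. H r i) n)" for n
    by (rule evals_Comp2) (auto intro!: evals_PrimRec evals_Proj evals_Comp2 simp: f h)
  show ?thesis unfolding computable_def using z by blast
qed

lemma computable3_proj:
  shows computable3_1: "computable3 (\<lambda>l m n. l)"
    and computable3_2: "computable3 (\<lambda>l m n. m)"
    and computable3_3: "computable3 (\<lambda>l m n. n)"
  unfolding computable3_def
  subgoal by (intro exI[of _ "Proj 0"]) (auto intro!: evals_Proj)
  subgoal by (intro exI[of _ "Proj 1"]) (auto intro!: evals_Proj)
  subgoal by (intro exI[of _ "Proj 2"]) (auto intro!: evals_Proj)
  done

lemma computable3_comp: "computable F \<Longrightarrow> computable3 G \<Longrightarrow> computable3 (\<lambda>l m n. F (G l m n))"
  unfolding computable_def computable3_def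
  by (elim exE, rule_tac x = "Comp f [fa]" in exI) (intro allI evals_Comp1; blast)

lemma computable3_comp2:
  "computable2 F \<Longrightarrow> computable3 G \<Longrightarrow> computable3 H \<Longrightarrow>
    computable3 (\<lambda>l m n. F (G l m n) (H l m n))"
  unfolding computable2_def computable3_def
  by (elim exE, rule_tac x = "Comp f [fa, fb]" in exI) (intro allI evals_Comp2; blast)

section \<open>Arithmetic and Cantor's pairing\<close>

lemma computable_Suc: "computable Suc"
  unfolding computable_def by (rule exI[of _ Succ]) (simp add: evals.Succ)

lemma computable2_add: "computable2 (+)"
proof -
  have "computable2 (\<lambda>n x. rec_nat x (\<lambda>i r. Suc r) n)"
    by (intro computable2_rec_nat computable_id computable3_comp[OF computable_Suc] computable3_1)
  moreover have "rec_nat x (\<lambda>i r. Suc r) n = n + x" for n x :: nat by (induction n) auto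
  ultimately show ?thesis by simp
qed

lemma computable2_diff: "computable2 (-)"
proof -
  have "computable (rec_nat 0 (\<lambda>i r. i))"
    by (rule computable_rec_nat_closed computable2_snd)+
  moreover have "rec_nat 0 (\<lambda>i r. i) = (\<lambda>n. n - 1 :: nat)"
  proof
    fix n show "rec_nat 0 (\<lambda>i r. i) n = n - 1" by (cases n) auto
  qed
  ultimately have pred: "computable (\<lambda>n. n - 1)" by simp
  have "computable2 (\<lambda>n x. rec_nat x (\<lambda>i r. r - 1) n)"
    by (intro computable2_rec_nat computable_id computable3_comp[OF pred] computable3_1)
  moreover have "rec_nat x (\<lambda>i r. r - 1) n = x - n" for n x :: nat by (induction n) auto
  ultimately have "computable2 (\<lambda>n x. x - n)" by simp
  from computable2_comp2[OF this computable2_snd computable2_fst] show ?thesis by simp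
qed

lemma computable2_prod_encode: "computable2 (\<lambda>m n. prod_encode (m, n))"
  and computable_triangle: "computable triangle"
proof -
  have "computable (rec_nat 0 (\<lambda>i r. r + Suc i))"
    by (intro computable_rec_nat_closed computable2_comp2[OF computable2_add] computable2_fst
        computable2_comp[OF computable_Suc] computable2_snd)
  moreover have "rec_nat 0 (\<lambda>i r. r + Suc i) = triangle"
  proof
    fix n show "rec_nat 0 (\<lambda>i r. r + Suc i) n = triangle n" by (induction n) auto
  qed
  ultimately show triangle: "computable triangle" by simp
  show "computable2 (\<lambda>m n. prod_encode (m, n))"
    unfolding prod_encode_def split
    by (intro computable2_comp2[OF computable2_add] computable2_comp[OF triangle]
        computable2_fst computable2_snd)
qed

lemma computable2_if_eq:
  assumes "computable2 A" "computable2 B" "computable2 C" "computable2 D"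
  shows "computable2 (\<lambda>m n. if A m n = B m n then C m n else D m n)"
proof -
  have 1: "computable2 (\<lambda>d x. rec_nat x (\<lambda>i r. 0) d)"
    by (intro computable2_rec_nat computable_id computable3_comp[OF computable_const computable3_1])
  \<comment> \<open>The two truncated differences add up to 0 exactly in case of equality, and
    \<open>rec_nat c (\<lambda>i r. 0) d\<close> keeps \<open>c\<close> for \<open>d = 0\<close> and
    erases it otherwise; so exactly one summand is kept.\<close>
  have "computable2 (\<lambda>m n. rec_nat (C m n) (\<lambda>i r. 0) ((A m n - B m n) + (B m n - A m n))
     + rec_nat (D m n) (\<lambda>i r. 0) (1 - ((A m n - B m n) + (B m n - A m n))))"
    by (intro computable2_comp2[OF computable2_add] computable2_comp2[OF computable2_diff]
       computable2_comp2[OF 1] computable2_const assms)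
  moreover have "rec_nat c (\<lambda>i r. 0) ((a - b) + (b - a)) + rec_nat d (\<lambda>i r. 0) (1 - ((a - b) + (b - a)))
      = (if a = b then c else d)" for a b c d :: nat
    by (cases "(a - b) + (b - a)") auto
  ultimately show ?thesis by simp
qed

definition pfst :: "nat \<Rightarrow> nat" where "pfst n = fst (prod_decode n)"
definition psnd :: "nat \<Rightarrow> nat" where "psnd n = snd (prod_decode n)"

lemma pfst_encode [simp]: "pfst (prod_encode (a, b)) = a"
  and psnd_encode [simp]: "psnd (prod_encode (a, b)) = b"
  by (simp_all add: pfst_def psnd_def)

lemma encode_pfst_psnd [simp]: "prod_encode (pfst n, psnd n) = n"
  by (simp add: pfst_def psnd_def)

lemma triangle_pfst_psnd: "triangle (pfst n + psnd n) + pfst n = n"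
  using encode_pfst_psnd[of n] by (simp add: prod_encode_def)

text \<open>The index of the diagonal containing \<open>n\<close> in Cantor's enumeration of pairs increases exactly
  at the triangular numbers.\<close>

lemma computable_diagonal: "computable (\<lambda>n. pfst n + psnd n)"
proof -
  let ?H = "\<lambda>r i. if triangle (Suc r) = Suc i then Suc r else r"
  have *: "rec_nat 0 (\<lambda>i r. ?H r i) n = pfst n + psnd n" for n
  proof (induction n)
    case 0
    have "prod_encode (0, 0) = 0" by (simp add: prod_encode_def)
    then show ?case using pfst_encode[of 0 0] psnd_encode[of 0 0] by simp
  next
    case (Suc n)
    define a b where "a = pfst n" and "b = psnd n"
    have n: "n = triangle (a + b) + a" unfolding a_def b_def by (simp only: triangle_pfst_psnd)
    \<comment> \<open>One step along a diagonal, or from its end to the start of the next.\<close>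
    have Suc_n: "Suc n = (if b = 0 then prod_encode (0, Suc a) else prod_encode (Suc a, b - 1))"
      by (cases b) (auto simp: n prod_encode_def)
    have "pfst (Suc n) + psnd (Suc n) = (if b = 0 then Suc (a + b) else a + b)"
      unfolding Suc_n by auto
    moreover have "(triangle (Suc (a + b)) = Suc n) = (b = 0)" by (simp add: n)
    ultimately show ?case using Suc by (simp add: a_def b_def)
  qed
  have "computable (rec_nat 0 (\<lambda>i r. ?H r i))"
    by (intro computable_rec_nat_closed computable2_if_eq computable2_comp[OF computable_triangle]
        computable2_comp[OF computable_Suc] computable2_fst computable2_snd)
  moreover have "rec_nat 0 (\<lambda>i r. ?H r i) = (\<lambda>n. pfst n + psnd n)" using * by blast
  ultimately show ?thesis by simp
qed

lemma computable_pfst_closed: "computable pfst"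
proof -
  have "computable (\<lambda>n. n - triangle (pfst n + psnd n))"
    by (intro computable_comp2[OF computable2_diff] computable_id
        computable_comp[OF computable_triangle computable_diagonal])
  moreover have "n - triangle (pfst n + psnd n) = pfst n" for n
    using triangle_pfst_psnd[of n] by linarith
  ultimately show ?thesis by simp
qed

lemma computable_psnd_closed: "computable psnd"
proof -
  have "computable (\<lambda>n. (pfst n + psnd n) - pfst n)"
    by (intro computable_comp2[OF computable2_diff] computable_diagonal computable_pfst_closed)
  then show ?thesis by simp
qed

section \<open>Syntax-directed closure rules\<close>

named_theorems comp

text \<open>Each rule allows arbitrary computable arguments, so \<open>intro comp\<close> proves
  computability by following the structure of the term.\<close>

lemmas [comp] = computable_id computable_const
  computable_comp[OF computable_Suc] computable_comp[OF computable_pfst_closed]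
  computable_comp[OF computable_psnd_closed]
  computable_comp2[OF computable2_add] computable_comp2[OF computable2_diff]
  computable_comp2[OF computable2_prod_encode]

text \<open>Packing index, accumulator and parameter into one nested pair makes the step function
  unary, so its computability is again a goal for the same rules.\<close>

lemma computable_rec_nat [comp]:
  assumes "computable N" "computable A" "computable (\<lambda>p. H (pfst p) (pfst (psnd p)) (psnd (psnd p)))"
  shows "computable (\<lambda>x. rec_nat (A x) (\<lambda>i r. H i r x) (N x))"
proof -
  have "computable3 (\<lambda>r i x. prod_encode (i, prod_encode (r, x)))"
    by (intro computable3_comp2[OF computable2_prod_encode] computable3_proj)
  from computable3_comp[OF assms(3) this]
  have "computable3 (\<lambda>r i x. H i r x)" by simp
  from computable_comp2[OF computable2_rec_nat[OF assms(2) this] assms(1) computable_id]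
  show ?thesis .
qed

section \<open>Decidable predicates and bounded quantifiers\<close>

definition decidable :: "(nat \<Rightarrow> bool) \<Rightarrow> bool" where
  "decidable P \<longleftrightarrow> computable (\<lambda>n. if P n then 1 else 0)"

lemma recursive_set_iff_decidable: "recursive_set A \<longleftrightarrow> decidable (\<lambda>n. n \<in> A)"
  by (simp add: recursive_set_def decidable_def computable_def)

lemma computable_if [comp]:
  assumes "decidable P" "computable A" "computable B"
  shows "computable (\<lambda>n. if P n then A n else B n)"
proof -
  have "computable (\<lambda>n. rec_nat (B n) (\<lambda>_ _. A n) (if P n then 1 else 0))"
    by (intro comp assms assms(1)[unfolded decidable_def] computable_comp[OF assms(2)])
  moreover have "rec_nat (B n) (\<lambda>_ _. A n) (if P n then 1 else 0) = (if P n then A n else B n)" for n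
    by simp
  ultimately show ?thesis by simp
qed

lemma decidable_cong: "decidable P \<Longrightarrow> (\<And>n. P n = Q n) \<Longrightarrow> decidable Q"
  by (simp add: decidable_def)

lemma decidable_comp: "decidable P \<Longrightarrow> computable F \<Longrightarrow> decidable (\<lambda>n. P (F n))"
  unfolding decidable_def by (rule computable_comp)

lemma decidable_const [comp]: "decidable (\<lambda>_. c)"
  unfolding decidable_def by (rule computable_const)

lemma decidable_le [comp]:
  assumes "computable A" "computable B"
  shows "decidable (\<lambda>n. A n \<le> B n)"
proof -
  have "computable (\<lambda>n. 1 - (A n - B n))" by (intro comp assms)
  moreover have "1 - (A n - B n) = (if A n \<le> B n then 1 else 0)" for n by auto
  ultimately show ?thesis by (simp add: decidable_def)
qed

lemma decidable_not [comp]: "decidable P \<Longrightarrow> decidable (\<lambda>n. \<not> P n)"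
proof -
  assume "decidable P"
  then have "computable (\<lambda>n. if P n then 0 else 1)" by (intro comp)
  moreover have "(if P n then 0 else 1) = (if \<not> P n then 1 else (0::nat))" for n by simp
  ultimately show ?thesis by (simp only: decidable_def)
qed

lemma decidable_if [comp]:
  "decidable P \<Longrightarrow> decidable Q \<Longrightarrow> decidable R \<Longrightarrow> decidable (\<lambda>n. if P n then Q n else R n)"
proof -
  assume "decidable P" "decidable Q" "decidable R"
  then have "computable (\<lambda>n. if P n then if Q n then 1 else 0 else if R n then 1 else 0)"
    by (intro comp)
  moreover have "(if P n then if Q n then 1 else 0 else if R n then 1 else 0)
      = (if (if P n then Q n else R n) then 1 else (0::nat))" for n by simp
  ultimately show ?thesis by (simp only: decidable_def)
qed

lemma decidable_conj [comp]: "decidable P \<Longrightarrow> decidable Q \<Longrightarrow> decidable (\<lambda>n. P n \<and> Q n)"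
  by (rule decidable_cong[OF decidable_if[of P Q "\<lambda>_. False"]]) (auto intro: decidable_const)

lemma decidable_disj [comp]: "decidable P \<Longrightarrow> decidable Q \<Longrightarrow> decidable (\<lambda>n. P n \<or> Q n)"
  by (rule decidable_cong[OF decidable_if[of P "\<lambda>_. True" Q]]) (auto intro: decidable_const)

lemma decidable_imp [comp]: "decidable P \<Longrightarrow> decidable Q \<Longrightarrow> decidable (\<lambda>n. P n \<longrightarrow> Q n)"
  by (rule decidable_cong[OF decidable_if[of P Q "\<lambda>_. True"]]) (auto intro: decidable_const)

lemma decidable_iff [comp]: "decidable P \<Longrightarrow> decidable Q \<Longrightarrow> decidable (\<lambda>n. P n \<longleftrightarrow> Q n)"
proof -
  assume "decidable P" "decidable Q"
  then have "decidable (\<lambda>n. (P n \<longrightarrow> Q n) \<and> (Q n \<longrightarrow> P n))" by (intro comp)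
  then show ?thesis by (simp add: iff_conv_conj_imp)
qed

lemma decidable_eq [comp]: "computable A \<Longrightarrow> computable B \<Longrightarrow> decidable (\<lambda>n. A n = B n)"
  unfolding order_eq_iff[where 'a = nat] by (intro comp)

lemma decidable_less [comp]: "computable A \<Longrightarrow> computable B \<Longrightarrow> decidable (\<lambda>n. A n < B n)"
  unfolding less_eq_Suc_le by (intro comp)

lemma decidable_ball [comp]:
  assumes "computable B" "decidable (\<lambda>p. P (pfst p) (psnd p))"
  shows "decidable (\<lambda>n. \<forall>i < B n. P i n)"
proof -
  \<comment> \<open>The recursion step sees the triple of index, accumulator and parameter;
    repacking its outer components recovers the pair that \<open>P\<close> expects.\<close>
  have "decidable (\<lambda>q. P (pfst (prod_encode (pfst q, psnd (psnd q))))
       (psnd (prod_encode (pfst q, psnd (psnd q)))))"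
    by (rule decidable_comp[OF assms(2)]) (intro comp)
  then have D: "decidable (\<lambda>q. P (pfst q) (psnd (psnd q)))" by simp
  have "computable (\<lambda>n. rec_nat 1 (\<lambda>i r. if P i n then r else 0) (B n))"
    by (intro comp assms D)
  moreover have "rec_nat 1 (\<lambda>i r. if P i n then r else 0) b = (if \<forall>i<b. P i n then 1 else 0 :: nat)"
    for b n :: nat by (induction b) (auto simp: less_Suc_eq)
  ultimately show ?thesis by (simp only: decidable_def)
qed

lemma decidable_bex [comp]:
  assumes "computable B" "decidable (\<lambda>p. P (pfst p) (psnd p))"
  shows "decidable (\<lambda>n. \<exists>i < B n. P i n)"
proof -
  have "decidable (\<lambda>n. \<not> (\<forall>i < B n. \<not> P i n))" by (intro comp assms)
  then show ?thesis by simp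
qed

lemma computable_funpow [comp]:
  assumes "computable F" "computable N" "computable A"
  shows "computable (\<lambda>n. (F ^^ N n) (A n))"
proof -
  have "computable (\<lambda>n. rec_nat (A n) (\<lambda>_ r. F r) (N n))"
    by (intro comp assms computable_comp[OF assms(1)])
  moreover have "rec_nat a (\<lambda>_ r. F r) k = (F ^^ k) a" for a k by (induction k) auto
  ultimately show ?thesis by simp
qed

lemma computable_mult [comp]:
  assumes "computable A" "computable B" shows "computable (\<lambda>n. A n * B n)"
proof -
  have "computable (\<lambda>n. rec_nat 0 (\<lambda>_ r. r + B n) (A n))"
    by (intro comp assms computable_comp[OF assms(2)])
  moreover have "rec_nat 0 (\<lambda>_ r. r + b) a = a * b" for a b :: nat by (induction a) auto
  ultimately show ?thesis by simp
qed

lemma decidable_even [comp]: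
  assumes "computable A" shows "decidable (\<lambda>n. even (A n))"
proof -
  have "computable (\<lambda>n. rec_nat 1 (\<lambda>_ r. 1 - r) (A n))" by (intro comp assms)
  moreover have "rec_nat 1 (\<lambda>_ r. 1 - r :: nat) a = (if even a then 1 else 0)" for a :: nat
    by (induction a) auto
  ultimately show ?thesis by (simp add: decidable_def)
qed

lemma computable_half [comp]:
  assumes "computable A" shows "computable (\<lambda>n. A n div 2)"
proof -
  have "computable (\<lambda>n. rec_nat 0 (\<lambda>i r. if odd i then Suc r else r) (A n))" by (intro comp assms)
  moreover have "rec_nat 0 (\<lambda>i r. if odd i then Suc r else r) a = a div 2" for a :: nat
    by (induction a) (auto elim: oddE)
  ultimately show ?thesis by simp
qed

section \<open>A decidable relation with undecidable projection\<close>

lemma decidable_comp2: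
  assumes "decidable (\<lambda>p. P (pfst p) (psnd p))" "computable A" "computable B"
  shows "decidable (\<lambda>n. P (A n) (B n))"
proof -
  have "decidable (\<lambda>n. P (pfst (prod_encode (A n, B n))) (psnd (prod_encode (A n, B n))))"
    by (rule decidable_comp[OF assms(1)]) (intro comp assms)
  then show ?thesis by simp
qed

lemma computable_pow2 [comp]: "computable A \<Longrightarrow> computable (\<lambda>n. 2 ^ A n)"
proof -
  assume A: "computable A"
  have "computable (\<lambda>n. rec_nat 1 (\<lambda>_ r. 2 * r) (A n))" by (intro comp A)
  moreover have "rec_nat 1 (\<lambda>_ r. 2 * r) k = (2 ^ k :: nat)" for k by (induction k) auto
  ultimately show ?thesis by simp
qed

section \<open>Codes of finite sets, lists and recursive functions\<close>

lemma decidable_set_decode [comp]: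
  "computable A \<Longrightarrow> computable B \<Longrightarrow> decidable (\<lambda>n. A n \<in> set_decode (B n))"
proof -
  assume A: "computable A" and B: "computable B"
  have "decidable (\<lambda>n. odd (((\<lambda>x. x div 2) ^^ A n) (B n)))" by (intro comp A B)
  moreover have "((\<lambda>x. x div 2) ^^ k) m = m div 2 ^ k" for k m :: nat
    by (induction k) (auto simp: div_mult2_eq[symmetric] mult.commute)
  ultimately show ?thesis by (simp add: set_decode_def)
qed

definition lhd :: "nat \<Rightarrow> nat" where "lhd n = pfst (n - 1)"
definition ltl :: "nat \<Rightarrow> nat" where "ltl n = psnd (n - 1)"

lemma computable_lhd [comp]: "computable A \<Longrightarrow> computable (\<lambda>n. lhd (A n))"
  unfolding lhd_def by (intro comp)

lemma computable_ltl [comp]: "computable A \<Longrightarrow> computable (\<lambda>n. ltl (A n))"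
  unfolding ltl_def by (intro comp)

lemma lhd_list_encode [simp]: "lhd (list_encode (x # xs)) = x"
  by (simp add: lhd_def)

lemma ltl_list_encode [simp]: "ltl (list_encode xs) = list_encode (tl xs)"
proof -
  \<comment> \<open>Settles the empty list: its code is 0, truncated subtraction leaves 0, and this
    has to decode to the empty tail.\<close>
  have "prod_encode (0, 0) = 0" by (simp add: prod_encode_def)
  then have "psnd 0 = 0" using psnd_encode[of 0 0] by simp
  then show ?thesis by (cases xs) (simp_all add: ltl_def)
qed

lemma funpow_ltl_list_encode [simp]: "(ltl ^^ i) (list_encode xs) = list_encode (drop i xs)"
  by (induction i) (simp_all add: drop_Suc tl_drop)

lemma list_encode_eq_0 [simp]: "list_encode xs = 0 \<longleftrightarrow> xs = []"
  by (cases xs) auto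

text \<open>Makes the code of a list a computable bound on its positions.\<close>

lemma length_le_list_encode: "length xs \<le> list_encode xs"
proof (induction xs)
  case (Cons x xs)
  then show ?case using le_prod_encode_2[of "list_encode xs" x] by simp
qed simp

lemma lhd_drop: "i < length xs \<Longrightarrow> lhd (list_encode (drop i xs)) = xs ! i"
  by (metis Cons_nth_drop_Suc lhd_list_encode)

fun recf_code :: "recf \<Rightarrow> nat" where
  "recf_code Zero = prod_encode (0, 0)"
| "recf_code Succ = prod_encode (1, 0)"
| "recf_code (Proj i) = prod_encode (2, i)"
| "recf_code (Comp f gs) = prod_encode (3, prod_encode (recf_code f, list_encode (map recf_code gs)))"
| "recf_code (PrimRec f g) = prod_encode (4, prod_encode (recf_code f, recf_code g))"
| "recf_code (Mu f) = prod_encode (5, recf_code f)"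

section \<open>Judgements and their derivation rules\<close>

definition triple :: "nat \<Rightarrow> nat \<Rightarrow> nat \<Rightarrow> nat" where
  "triple c xs y = prod_encode (c, prod_encode (xs, y))"

abbreviation judgement :: "recf \<Rightarrow> nat list \<Rightarrow> nat \<Rightarrow> nat" where
  "judgement f xs y \<equiv> triple (recf_code f) (list_encode xs) y"

abbreviation lcons :: "nat \<Rightarrow> nat \<Rightarrow> nat" where
  "lcons x xs \<equiv> Suc (prod_encode (x, xs))"

lemma computable_triple [comp]:
  "computable A \<Longrightarrow> computable B \<Longrightarrow> computable C \<Longrightarrow> computable (\<lambda>n. triple (A n) (B n) (C n))"
  unfolding triple_def by (intro comp)

text \<open>One-step derivability from the judgements in \<open>S\<close>, with \<^const>\<open>recf_code\<close> decoded in place: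
  \<open>c\<close> codes a function, \<open>xs\<close> its argument list.\<close>

definition follows :: "nat set \<Rightarrow> nat \<Rightarrow> nat \<Rightarrow> nat \<Rightarrow> bool" where
  "follows S c xs y \<longleftrightarrow>
     pfst c = 0 \<and> y = 0 \<or>
     pfst c = 1 \<and> 0 < y \<and> xs = lcons (y - 1) 0 \<or>
     pfst c = 2 \<and> (ltl ^^ psnd c) xs \<noteq> 0 \<and> y = lhd ((ltl ^^ psnd c) xs) \<or>
     pfst c = 3 \<and> (\<exists>ys. triple (pfst (psnd c)) ys y \<in> S \<and>
       (\<forall>i < Suc (psnd (psnd c)). ((ltl ^^ i) (psnd (psnd c)) = 0 \<longleftrightarrow> (ltl ^^ i) ys = 0) \<and>
         ((ltl ^^ i) ys \<noteq> 0 \<longrightarrow>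
            triple (lhd ((ltl ^^ i) (psnd (psnd c)))) xs (lhd ((ltl ^^ i) ys)) \<in> S))) \<or>
     pfst c = 4 \<and> xs \<noteq> 0 \<and> (if lhd xs = 0 then triple (pfst (psnd c)) (ltl xs) y \<in> S
       else \<exists>r. triple c (lcons (lhd xs - 1) (ltl xs)) r \<in> S \<and>
         triple (psnd (psnd c)) (lcons r (lcons (lhd xs - 1) (ltl xs))) y \<in> S) \<or>
     pfst c = 5 \<and> triple (psnd c) (lcons y xs) 0 \<in> S \<and>
       (\<forall>i < y. \<exists>z. triple (psnd c) (lcons i xs) (Suc z) \<in> S)"

lemma set_decode_less: "j \<in> set_decode e \<Longrightarrow> j < e"
proof -
  assume "j \<in> set_decode e"
  then have "e div 2 ^ j \<noteq> 0" by (auto simp: set_decode_def intro: Nat.gr0I)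
  then have "2 ^ j \<le> e" by (simp add: div_eq_0_iff)
  then show "j < e" using less_exp[of j] by linarith
qed

lemma triple_less: "triple c xs y \<in> set_decode e \<Longrightarrow> xs < e" "triple c xs y \<in> set_decode e \<Longrightarrow> y < e"
  using set_decode_less[of "triple c xs y" e] le_prod_encode_1[of xs y] le_prod_encode_2[of y xs]
    le_prod_encode_2[of "prod_encode (xs, y)" c]
  unfolding triple_def by linarith+

text \<open>Every witness is a component of a judgement in the finite set, hence below the code
  \<open>e\<close> of that set. Bounded quantifiers make the rules decidable.\<close>

lemma follows_bounded: "follows (set_decode e) c xs y \<longleftrightarrow>
     pfst c = 0 \<and> y = 0 \<or>
     pfst c = 1 \<and> 0 < y \<and> xs = lcons (y - 1) 0 \<or>
     pfst c = 2 \<and> (ltl ^^ psnd c) xs \<noteq> 0 \<and> y = lhd ((ltl ^^ psnd c) xs) \<or>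
     pfst c = 3 \<and> (\<exists>ys<e. triple (pfst (psnd c)) ys y \<in> set_decode e \<and>
       (\<forall>i < Suc (psnd (psnd c)). ((ltl ^^ i) (psnd (psnd c)) = 0 \<longleftrightarrow> (ltl ^^ i) ys = 0) \<and>
         ((ltl ^^ i) ys \<noteq> 0 \<longrightarrow>
            triple (lhd ((ltl ^^ i) (psnd (psnd c)))) xs (lhd ((ltl ^^ i) ys)) \<in> set_decode e))) \<or>
     pfst c = 4 \<and> xs \<noteq> 0 \<and> (if lhd xs = 0 then triple (pfst (psnd c)) (ltl xs) y \<in> set_decode e
       else \<exists>r<e. triple c (lcons (lhd xs - 1) (ltl xs)) r \<in> set_decode e \<and>
         triple (psnd (psnd c)) (lcons r (lcons (lhd xs - 1) (ltl xs))) y \<in> set_decode e) \<or>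
     pfst c = 5 \<and> triple (psnd c) (lcons y xs) 0 \<in> set_decode e \<and>
       (\<forall>i < y. \<exists>z<e. triple (psnd c) (lcons i xs) (Suc z) \<in> set_decode e)"
proof -
  have 1: "(\<exists>ys. triple c ys y \<in> set_decode e \<and> P ys) \<longleftrightarrow> (\<exists>ys<e. triple c ys y \<in> set_decode e \<and> P ys)"
    and 2: "(\<exists>r. triple c ys r \<in> set_decode e \<and> P r) \<longleftrightarrow> (\<exists>r<e. triple c ys r \<in> set_decode e \<and> P r)"
    and 3: "(\<exists>r. triple c ys (Suc r) \<in> set_decode e) \<longleftrightarrow> (\<exists>r<e. triple c ys (Suc r) \<in> set_decode e)"
    for c ys y P
    using triple_less by (blast, blast, meson Suc_lessD)
  show ?thesis unfolding follows_def by (subst 1, subst 2, subst 3) (rule refl)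
qed

lemma decidable_follows_closed:
  "decidable (\<lambda>p. follows (set_decode (pfst p)) (pfst (psnd p)) (pfst (psnd (psnd p))) (psnd (psnd (psnd p))))"
  unfolding follows_bounded by (intro comp)

text \<open>The set \<open>S\<close> occurs only positively in the rules.\<close>

lemma follows_mono: "S \<subseteq> S' \<Longrightarrow> follows S c xs y \<Longrightarrow> follows S' c xs y"
  unfolding follows_def by (elim disjE) (auto 0 5 split: if_splits)

lemma follows_Zero: "follows S (recf_code Zero) (list_encode xs) y \<longleftrightarrow> y = 0"
  by (simp add: follows_def)

lemma follows_Succ: "follows S (recf_code Succ) (list_encode xs) y \<longleftrightarrow> (\<exists>x. xs = [x] \<and> y = Suc x)"
proof -
  have "list_encode xs = lcons x 0 \<longleftrightarrow> xs = [x]" for x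
    using list_encode_eq[of xs "[x]"] by simp
  then show ?thesis by (cases y) (simp_all add: follows_def)
qed

lemma follows_Proj:
  "follows S (recf_code (Proj i)) (list_encode xs) y \<longleftrightarrow> i < length xs \<and> y = xs ! i"
  by (cases "i < length xs") (auto simp: follows_def lhd_drop)

lemma follows_Comp: "follows S (recf_code (Comp f gs)) (list_encode xs) y \<longleftrightarrow>
  (\<exists>ys. judgement f ys y \<in> S \<and> list_all2 (\<lambda>g y. judgement g xs y \<in> S) gs ys)" (is "?l \<longleftrightarrow> ?r")
proof -
  let ?cs = "map recf_code gs"
  let ?P = "\<lambda>i ys. (drop i ?cs = [] \<longleftrightarrow> drop i ys = []) \<and>
         (drop i ys \<noteq> [] \<longrightarrow> triple (lhd (list_encode (drop i ?cs))) (list_encode xs)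
            (lhd (list_encode (drop i ys))) \<in> S)"
  have *: "(\<forall>i < Suc (list_encode ?cs). ?P i ys) \<longleftrightarrow>
      list_all2 (\<lambda>g y. judgement g xs y \<in> S) gs ys" (is "?a \<longleftrightarrow> ?b") for ys
  proof
    assume a: ?a
    have n: "length gs \<le> list_encode ?cs" using length_le_list_encode[of ?cs] by simp
    \<comment> \<open>Position \<open>length gs\<close>, just past the end, exposes a longer
      \<open>ys\<close>, and position \<open>length ys\<close> a shorter one. The \<open>Suc\<close>
      in the bound keeps such a test even for an empty list, whose code is 0.\<close>
    have "length ys \<le> length gs" using a n by (auto dest!: spec[of _ "length gs"])
    moreover have "length gs \<le> length ys" 
    proof (rule ccontr)
      assume "\<not> length gs \<le> length ys"
      then show False using a n by (auto dest!: spec[of _ "length ys"])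
    qed
    ultimately have len: "length gs = length ys" by simp
    moreover have "judgement (gs ! i) xs (ys ! i) \<in> S" if "i < length ys" for i
    proof -
      have "?P i ys" using a n that len by simp
      then show ?thesis using that len by (simp add: lhd_drop)
    qed
    ultimately show ?b by (simp add: list_all2_conv_all_nth)
  next
    assume ?b then show ?a by (auto simp: list_all2_conv_all_nth lhd_drop)
  qed
  have surj: "(\<exists>n. Q n) \<longleftrightarrow> (\<exists>ys. Q (list_encode ys))" for Q
    using list_decode_inverse by (intro iffI; elim exE) (rule exI[of _ "list_decode _"], simp, blast)
  show ?thesis by (subst *[symmetric]) (simp add: follows_def del: neq0_conv add: surj[of "\<lambda>n. _ n \<and> _ n"])
qed

lemma follows_PrimRec_Nil: "\<not> follows S (recf_code (PrimRec f g)) (list_encode []) y"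
  by (simp add: follows_def)

lemma follows_PrimRec_0:
  "follows S (recf_code (PrimRec f g)) (list_encode (0 # xs)) y \<longleftrightarrow> judgement f xs y \<in> S"
  using lhd_list_encode[of 0 xs] ltl_list_encode[of "0 # xs"] by (simp add: follows_def)

lemma follows_PrimRec_Suc:
  "follows S (recf_code (PrimRec f g)) (list_encode (Suc n # xs)) y \<longleftrightarrow>
    (\<exists>r. judgement (PrimRec f g) (n # xs) r \<in> S \<and> judgement g (r # n # xs) y \<in> S)"
  using lhd_list_encode[of "Suc n" xs] ltl_list_encode[of "Suc n # xs"] by (simp add: follows_def)

lemma follows_Mu:
  "follows S (recf_code (Mu f)) (list_encode xs) y \<longleftrightarrow>
    judgement f (y # xs) 0 \<in> S \<and> (\<forall>i < y. \<exists>z. judgement f (i # xs) (Suc z) \<in> S)"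
  by (simp add: follows_def)

section \<open>Finite stages of the inductive definition\<close>

text \<open>Each stage adds the judgements with small code that follow in one step from the previous stage.
  Cutting off by the code keeps every stage finite, so that it is coded by one number and the
  sequence of stages is primitive recursive.\<close>

definition next_stage :: "nat \<Rightarrow> nat \<Rightarrow> nat" where
  "next_stage t e = rec_nat 0 (\<lambda>j s. if follows (set_decode e) (pfst j) (pfst (psnd j)) (psnd (psnd j))
     then s + 2 ^ j else s) (Suc t)"

definition stage :: "nat \<Rightarrow> nat" where
  "stage = rec_nat 0 next_stage"

lemma computable_stage [comp]: "computable A \<Longrightarrow> computable (\<lambda>n. stage (A n))"
proof -
  have [comp]: "decidable (\<lambda>n. follows (set_decode (A n)) (pfst (B n)) (pfst (psnd (B n))) (psnd (psnd (B n))))"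
    if "computable A" "computable B" for A B
    by (rule decidable_comp2[OF decidable_follows_closed that])
  assume "computable A"
  then have "computable (\<lambda>n. rec_nat 0 (\<lambda>t e. next_stage t e) (A n))"
    unfolding next_stage_def by (intro comp)
  then show ?thesis by (simp add: stage_def)
qed

lemma stage_0 [simp]: "set_decode (stage 0) = {}"
  by (simp add: stage_def)

lemma set_decode_stage_Suc: "set_decode (stage (Suc t)) =
  {j. j \<le> t \<and> follows (set_decode (stage t)) (pfst j) (pfst (psnd j)) (psnd (psnd j))}"
proof -
  \<comment> \<open>Each power \<open>2 ^ j\<close> is added at most once, so addition acts as
    insertion into the coded set.\<close>
  have "rec_nat 0 (\<lambda>j s. if P j then s + 2 ^ j else s) k = set_encode {j. j < k \<and> P j}" for P k
  proof (induction k)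
    case (Suc k)
    have "{j. j < Suc k \<and> P j} = (if P k then insert k {j. j < k \<and> P j} else {j. j < k \<and> P j})"
      by (auto simp: less_Suc_eq)
    with Suc show ?case by simp
  qed simp
  moreover have "stage (Suc t) = next_stage t (stage t)" by (simp add: stage_def)
  ultimately have "stage (Suc t) = set_encode {j. j < Suc t \<and>
      follows (set_decode (stage t)) (pfst j) (pfst (psnd j)) (psnd (psnd j))}"
    by (simp only: next_stage_def)
  then show ?thesis by (simp add: less_Suc_eq_le)
qed

lemma in_stage_Suc: "triple c xs y \<in> set_decode (stage (Suc t)) \<longleftrightarrow>
  triple c xs y \<le> t \<and> follows (set_decode (stage t)) c xs y"
  by (simp add: set_decode_stage_Suc triple_def)

lemma stage_mono: "t \<le> u \<Longrightarrow> set_decode (stage t) \<subseteq> set_decode (stage u)"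
proof -
  have "set_decode (stage t) \<subseteq> set_decode (stage (Suc t))" for t
    by (induction t) (auto simp: set_decode_stage_Suc intro: follows_mono)
  then show "t \<le> u \<Longrightarrow> ?thesis" by (rule lift_Suc_mono_le)
qed

lemma stage_sound: "judgement f xs y \<in> set_decode (stage t) \<Longrightarrow> evals f xs y"
proof (induction t arbitrary: f xs y)
  case (Suc t)
  then have F: "follows (set_decode (stage t)) (recf_code f) (list_encode xs) y"
    by (simp add: in_stage_Suc)
  show ?case
  proof (cases f)
    case Zero
    then show ?thesis using F unfolding Zero follows_Zero by (auto intro: evals.Zero)
  next
    case Succ
    then show ?thesis using F unfolding Succ follows_Succ by (auto intro: evals.Succ)
  next
    case (Proj i)
    then show ?thesis using F unfolding Proj follows_Proj by (auto intro: evals.Proj)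
  next
    case (Comp g hs)
    then obtain ys where ys: "judgement g ys y \<in> set_decode (stage t)"
      "list_all2 (\<lambda>h y. judgement h xs y \<in> set_decode (stage t)) hs ys"
      using F unfolding Comp follows_Comp by blast
    from ys(2) have "list_all2 (\<lambda>h y. evals h xs y) hs ys"
      by (rule list_all2_mono) (rule Suc.IH)
    then show ?thesis using Comp Suc.IH[OF ys(1)] evals.Comp by blast
  next
    case (PrimRec g h)
    then obtain n ns where xs: "xs = n # ns" using F follows_PrimRec_Nil by (cases xs) auto
    show ?thesis
    proof (cases n)
      case 0
      then show ?thesis using F unfolding xs PrimRec 0 follows_PrimRec_0
        by (intro evals.PrimRec_0 Suc.IH)
    next
      case (Suc m)
      then obtain r where "judgement (PrimRec g h) (m # ns) r \<in> set_decode (stage t)"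
        "judgement h (r # m # ns) y \<in> set_decode (stage t)"
        using F unfolding xs PrimRec Suc follows_PrimRec_Suc by blast
      then show ?thesis unfolding xs PrimRec Suc by (intro evals.PrimRec_Suc[of g h m ns r] Suc.IH)
    qed
  next
    case (Mu g)
    then show ?thesis using F unfolding Mu follows_Mu by (blast intro: evals.Mu Suc.IH)
  qed
qed simp

text \<open>A judgement whose code exceeds the cutoff only has to wait: its premises persist by
  monotonicity until the stage number has passed the code.\<close>

lemma follows_stage:
  "follows (set_decode (stage t)) c xs y \<Longrightarrow> \<exists>u. triple c xs y \<in> set_decode (stage u)"
proof
  assume "follows (set_decode (stage t)) c xs y"
  then have "follows (set_decode (stage (max t (triple c xs y)))) c xs y"
    by (rule follows_mono[OF stage_mono[OF max.cobounded1]])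
  then show "triple c xs y \<in> set_decode (stage (Suc (max t (triple c xs y))))"
    by (simp add: in_stage_Suc)
qed

text \<open>Composition and minimization have unboundedly many, but finitely many, premises; since
  the stages increase, one stage contains them all.\<close>

lemma stage_uniform:
  fixes n :: nat
  assumes "\<And>i. i < n \<Longrightarrow> \<exists>t. P i \<in> set_decode (stage t)"
  shows "\<exists>t. \<forall>i<n. P i \<in> set_decode (stage t)"
  using assms
proof (induction n)
  case (Suc n)
  then obtain t u where "\<forall>i<n. P i \<in> set_decode (stage t)" "P n \<in> set_decode (stage u)"
    by (meson lessI less_SucI)
  then have "\<forall>i<Suc n. P i \<in> set_decode (stage (max t u))"
    using stage_mono[of t "max t u"] stage_mono[of u "max t u"] by (auto simp: less_Suc_eq)
  then show ?case by blast
qed simp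

lemma stage_uniform2:
  assumes "P \<in> set_decode (stage t)" "Q \<in> set_decode (stage u)"
  shows "\<exists>t. P \<in> set_decode (stage t) \<and> Q \<in> set_decode (stage t)"
  using assms stage_mono[of t "max t u"] stage_mono[of u "max t u"] by auto

lemma stage_complete: "evals f xs y \<Longrightarrow> \<exists>t. judgement f xs y \<in> set_decode (stage t)"
proof (induction f xs y rule: evals.induct)
  case (Zero xs)
  then show ?case by (intro follows_stage[of 0] follows_Zero[THEN iffD2]) simp
next
  case (Succ x)
  then show ?case by (intro follows_stage[of 0] follows_Succ[THEN iffD2]) simp
next
  case (Proj i xs)
  then show ?case by (intro follows_stage[of 0] follows_Proj[THEN iffD2]) simp
next
  case (Comp xs gs ys f z)
  from Comp.IH(1) have len: "length gs = length ys"
    and "\<And>i. i < length gs \<Longrightarrow> \<exists>t. judgement (gs ! i) xs (ys ! i) \<in> set_decode (stage t)"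
    unfolding list_all2_conv_all_nth by blast+
  then obtain t where t: "\<forall>i<length gs. judgement (gs ! i) xs (ys ! i) \<in> set_decode (stage t)"
    using stage_uniform[of "length gs" "\<lambda>i. judgement (gs ! i) xs (ys ! i)"] by blast
  obtain u where u: "judgement f ys z \<in> set_decode (stage u)" using Comp by blast
  have "list_all2 (\<lambda>g y. judgement g xs y \<in> set_decode (stage (max t u))) gs ys"
    using t len stage_mono[of t "max t u"] by (auto simp: list_all2_conv_all_nth)
  moreover have "judgement f ys z \<in> set_decode (stage (max t u))"
    using u stage_mono[of u "max t u"] by auto
  ultimately show ?case
    by (intro follows_stage[of "max t u"] follows_Comp[THEN iffD2] exI[of _ ys] conjI)
next
  case (PrimRec_0 f xs y g)
  then obtain t where "judgement f xs y \<in> set_decode (stage t)" by blast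
  then show ?case by (intro follows_stage[of t] follows_PrimRec_0[THEN iffD2])
next
  case (PrimRec_Suc f g n xs r y)
  then obtain t where "judgement (PrimRec f g) (n # xs) r \<in> set_decode (stage t)"
    "judgement g (r # n # xs) y \<in> set_decode (stage t)"
    using stage_uniform2 by blast
  then show ?case by (intro follows_stage[of t] follows_PrimRec_Suc[THEN iffD2]) blast
next
  case (Mu f n xs)
  \<comment> \<open>The nonzero values are fixed beforehand, because \<open>stage_uniform\<close>
    needs a definite judgement for each index.\<close>
  then obtain z where z: "\<And>i. i < n \<Longrightarrow> \<exists>t. judgement f (i # xs) (Suc (z i)) \<in> set_decode (stage t)"
    by atomize_elim (intro choice; blast)
  obtain t where t: "\<forall>i<n. judgement f (i # xs) (Suc (z i)) \<in> set_decode (stage t)"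
    using stage_uniform[of n "\<lambda>i. judgement f (i # xs) (Suc (z i))", OF z] by blast
  obtain u where u: "judgement f (n # xs) 0 \<in> set_decode (stage u)" using Mu by blast
  have "\<forall>i<n. \<exists>z. judgement f (i # xs) (Suc z) \<in> set_decode (stage (max t u))"
    using t stage_mono[of t "max t u"] by (meson max.cobounded1 subsetD)
  moreover have "judgement f (n # xs) 0 \<in> set_decode (stage (max t u))"
    using u stage_mono[of u "max t u"] by auto
  ultimately show ?case by (intro follows_stage[of "max t u"] follows_Mu[THEN iffD2] conjI)
qed

section \<open>Diagonalization\<close>

lemma undecidable_projection:
  obtains T where "decidable (\<lambda>p. T (pfst p) (psnd p))" "\<not> decidable (\<lambda>n. \<exists>m. T n m)"
proof
  let ?T = "\<lambda>c m. triple c (lcons c 0) 0 \<in> set_decode (stage m)"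
  show "decidable (\<lambda>p. ?T (pfst p) (psnd p))" by (intro comp)
  have K: "(\<exists>m. ?T (recf_code f) m) \<longleftrightarrow> evals f [recf_code f] 0" for f
    using stage_sound[of f "[recf_code f]" 0] stage_complete[of f "[recf_code f]" 0] by auto
  show "\<not> decidable (\<lambda>n. \<exists>m. ?T n m)"
  proof
    assume "decidable (\<lambda>n. \<exists>m. ?T n m)"
    then obtain f where "\<And>n. evals f [n] (if \<exists>m. ?T n m then 1 else 0)"
      unfolding decidable_def computable_def by blast
    \<comment> \<open>On its own code, the decider would return 1 exactly when it returns 0.\<close>
    from this[of "recf_code f"] show False
      unfolding K by (auto split: if_splits dest: evals_deterministic)
  qed
qed

section \<open>The bi-infinite word\<close>

text \<open>The function starts with the pattern \<open>1 1 0\<^sup>m\<^sup>+\<^sup>1 1 0\<^sup>n\<^sup>+\<^sup>1 1 1\<close>.\<close>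

definition matches :: "(nat \<Rightarrow> bool) \<Rightarrow> nat \<Rightarrow> nat \<Rightarrow> bool" where
  "matches h n m \<longleftrightarrow> h 0 \<and> h 1 \<and> (\<forall>j < Suc m. \<not> h (j + 2)) \<and> h (m + 3) \<and>
     (\<forall>j < Suc n. \<not> h (m + 4 + j)) \<and> h (m + n + 5) \<and> h (m + n + 6)"

lemma matches_cong:
  assumes "\<And>j. j < m + n + 7 \<Longrightarrow> h j = h' j"
  shows "matches h n m \<longleftrightarrow> matches h' n m"
proof -
  have *: "h 0 = h' 0" "h 1 = h' 1" "h (m + 3) = h' (m + 3)" "h (m + n + 5) = h' (m + n + 5)"
    "h (m + n + 6) = h' (m + n + 6)" "\<And>j. j < Suc m \<Longrightarrow> h (j + 2) = h' (j + 2)"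
    "\<And>j. j < Suc n \<Longrightarrow> h (m + 4 + j) = h' (m + 4 + j)"
    by (rule assms; simp)+
  show ?thesis unfolding matches_def using * by blast
qed

lemma matches_inner:
  assumes "matches h n m" "h p" "2 \<le> p" "p < m + n + 5"
  shows "p = m + 3"
proof (rule ccontr)
  assume "p \<noteq> m + 3"
  then have "p < m + 3 \<or> m + 4 \<le> p" by linarith
  then show False
  proof
    assume "p < m + 3"
    then have "p - 2 < Suc m" "p = p - 2 + 2" using assms(3) by auto
    then show False using assms(1,2) unfolding matches_def by metis
  next
    assume "m + 4 \<le> p"
    then have "p - (m + 4) < Suc n" "p = m + 4 + (p - (m + 4))" using assms(4) by auto
    then show False using assms(1,2) unfolding matches_def by metis
  qed
qed

section \<open>Legality on codes of words\<close>

definition wtl :: "nat \<Rightarrow> nat" where "wtl c = (c - 1) div 2"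

lemma computable_wtl [comp]: "computable A \<Longrightarrow> computable (\<lambda>n. wtl (A n))"
  unfolding wtl_def by (intro comp)

text \<open>The lowest digit is 1 for the letter 0 and 2 for the letter 1; subtracting 1 and halving
  removes either. A nonzero code is even exactly when the first letter is 1.\<close>

lemma wtl_word_code [simp]: "wtl (word_code w) = word_code (tl w)"
  by (cases w) (auto simp: wtl_def)

lemma funpow_wtl_word_code [simp]: "(wtl ^^ i) (word_code w) = word_code (drop i w)"
  by (induction i) (simp_all add: drop_Suc tl_drop)

lemma word_code_eq_0 [simp]: "word_code w = 0 \<longleftrightarrow> w = []"
  by (cases w) auto

lemma even_word_code_drop: "i < length w \<Longrightarrow> even (word_code (drop i w)) \<longleftrightarrow> w ! i"
  by (subst Cons_nth_drop_Suc[symmetric]) auto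

lemma length_le_word_code: "length w \<le> word_code w"
  by (induction w) auto

definition legal :: "(nat \<Rightarrow> nat \<Rightarrow> bool) \<Rightarrow> bool list \<Rightarrow> bool" where
  "legal T w \<longleftrightarrow> (\<forall>i n m. i + m + n + 7 \<le> length w \<longrightarrow> matches (\<lambda>j. w ! (i + j)) n m \<longrightarrow> T n m)"

text \<open>The length of a word is at most its code, so \<open>c\<close> bounds all parameters.
  Past the end of the word the code is 0, which is even and would be read as the letter 1; the
  condition on \<open>i + m + n + 6\<close>, the last position of the pattern, excludes
  this.\<close>

definition legal_code :: "(nat \<Rightarrow> nat \<Rightarrow> bool) \<Rightarrow> nat \<Rightarrow> bool" where
  "legal_code T c \<longleftrightarrow> (\<forall>i<c. \<forall>n<c. \<forall>m<c. (wtl ^^ (i + m + n + 6)) c \<noteq> 0 \<longrightarrow>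
     matches (\<lambda>j. even ((wtl ^^ (i + j)) c)) n m \<longrightarrow> T n m)"

lemma legal_code_word_code [simp]: "legal_code T (word_code w) \<longleftrightarrow> legal T w"
proof -
  have M: "matches (\<lambda>j. even ((wtl ^^ (i + j)) (word_code w))) n m \<longleftrightarrow> matches (\<lambda>j. w ! (i + j)) n m"
    if "i + m + n + 7 \<le> length w" for i n m
    using that by (intro matches_cong) (simp add: even_word_code_drop)
  have L: "(wtl ^^ (i + m + n + 6)) (word_code w) \<noteq> 0 \<longleftrightarrow> i + m + n + 7 \<le> length w" for i n m
    unfolding funpow_wtl_word_code word_code_eq_0 by auto
  have B: "i < word_code w" "n < word_code w" "m < word_code w"
    if "i + m + n + 7 \<le> length w" for i n m
    using that length_le_word_code[of w] by linarith+
  show ?thesis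
  proof
    assume *: "legal_code T (word_code w)"
    show "legal T w"
      unfolding legal_def
    proof (intro allI impI)
      fix i n m assume "i + m + n + 7 \<le> length w" "matches (\<lambda>j. w ! (i + j)) n m"
      then show "T n m"
        using *[unfolded legal_code_def L, rule_format, of i n m] B[of i m n] M[of i m n] by blast
    qed
  next
    assume "legal T w"
    then show "legal_code T (word_code w)"
      unfolding legal_code_def legal_def L using M by (intro allI impI) simp
  qed
qed

section \<open>Blocks and their arrangement on the integers\<close>

text \<open>The letter of block \<open>a + b\<close> at distance \<open>a\<close> from its left and \<open>b\<close> from its right end. The block
  \<open>k\<close> consists of the word with code \<open>pfst k\<close>, provided that it is legal and fits, followed by
  \<open>0 \<dots> 0 1 0 1 0\<close>. Since \<open>pfst\<close> takes every value infinitely often, so does the sequence of words.\<close>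

definition block_letter :: "(nat \<Rightarrow> nat \<Rightarrow> bool) \<Rightarrow> nat \<Rightarrow> nat \<Rightarrow> bool" where
  "block_letter T a b \<longleftrightarrow>
     (if legal_code T (pfst (a + b)) \<and> 4 \<le> a + b \<and> (wtl ^^ (a + b - 4)) (pfst (a + b)) = 0 \<and>
        (wtl ^^ a) (pfst (a + b)) \<noteq> 0
      then even ((wtl ^^ a) (pfst (a + b))) else b = 1 \<or> b = 3)"

text \<open>Block \<open>k\<close> has \<open>k + 1\<close> letters, so
  \<open>length w + 4 \<le> k\<close> reserves five of them for \<open>01010\<close>. The conjunct
  \<open>4 \<le> a + b\<close> guards the truncated subtraction.\<close>

lemma block_letter_word:
  assumes "pfst k = word_code w" "a \<le> k"
  shows "block_letter T a (k - a) \<longleftrightarrow>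
    (if legal T w \<and> length w + 4 \<le> k \<and> a < length w then w ! a else k - a = 1 \<or> k - a = 3)"
proof -
  have "a + (k - a) = k" using assms(2) by simp
  moreover have "length w + 4 \<le> k \<longleftrightarrow> 4 \<le> k \<and> length w \<le> k - 4" by linarith
  ultimately show ?thesis
    by (simp add: block_letter_def assms(1) even_word_code_drop not_le del: neq0_conv cong: if_cong)
qed

text \<open>Cantor's enumeration of the pairs \<open>(a, b)\<close> runs through the diagonals \<open>a + b = k\<close>, that is, through
  the blocks from left to right. Exchanging \<open>a\<close> and \<open>b\<close> on the negative half keeps each block
  readable from left to right there.\<close>

definition block_word :: "(nat \<Rightarrow> nat \<Rightarrow> bool) \<Rightarrow> biword" where
  "block_word T i = (if 0 \<le> i then block_letter T (pfst (nat i)) (psnd (nat i))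
     else block_letter T (psnd (nat (- i - 1))) (pfst (nat (- i - 1))))"

lemma pfst_triangle: "a \<le> k \<Longrightarrow> pfst (triangle k + a) = a"
  and psnd_triangle: "a \<le> k \<Longrightarrow> psnd (triangle k + a) = k - a"
  using pfst_encode[of a "k - a"] psnd_encode[of a "k - a"] by (simp_all add: prod_encode_def)

lemma block_word_right: "a \<le> k \<Longrightarrow> block_word T (int (triangle k) + int a) = block_letter T a (k - a)"
  by (simp add: block_word_def pfst_triangle psnd_triangle nat_add_distrib)

lemma block_word_left:
  assumes "a \<le> k"
  shows "block_word T (- int (triangle k + k) - 1 + int a) = block_letter T a (k - a)"
proof -
  have "nat (- (- int (triangle k + k) - 1 + int a) - 1) = triangle k + (k - a)" using assms by simp
  moreover have "\<not> 0 \<le> - int (triangle k + k) - 1 + int a" using assms by simp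
  ultimately show ?thesis
    using assms by (simp only: block_word_def if_False pfst_triangle psnd_triangle diff_le_self) simp
qed

text \<open>Both halves present a block as an ascending interval from \<open>s\<close> to
  \<open>s + k\<close>, so occurrences of the pattern need no distinction between them.\<close>

lemma block_cover:
  obtains s k a where "i = s + int a" "a \<le> k"
    "\<And>b. b \<le> k \<Longrightarrow> block_word T (s + int b) = block_letter T b (k - b)"
proof (cases "0 \<le> i")
  case True
  let ?k = "pfst (nat i) + psnd (nat i)"
  have "i = int (triangle ?k) + int (pfst (nat i))"
    using triangle_pfst_psnd[of "nat i"] True by linarith
  then show ?thesis using that[of "int (triangle ?k)" "pfst (nat i)" ?k] block_word_right by simp
next
  case False
  let ?q = "nat (- i - 1)"
  let ?k = "pfst ?q + psnd ?q"
  have "i = - int (triangle ?k + ?k) - 1 + int (psnd ?q)"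
    using triangle_pfst_psnd[of ?q] False by linarith
  then show ?thesis by (rule that[OF _ le_add2 block_word_left])
qed

lemma block_word_legal:
  assumes M: "matches (\<lambda>j. block_word T (i + int j)) n m"
  shows "T n m"
proof -
  obtain s k a where i: "i = s + int a" and ak: "a \<le> k"
    and B: "\<And>b. b \<le> k \<Longrightarrow> block_word T (s + int b) = block_letter T b (k - b)"
    by (rule block_cover[where i = i and T = T], rule that)
  obtain w where w: "pfst k = word_code w" using bij_word_code by (metis bij_pointE)
  let ?ok = "legal T w \<and> length w + 4 \<le> k"
  let ?h = "\<lambda>b. block_word T (s + int b)"
  have h: "?h b \<longleftrightarrow> (if ?ok \<and> b < length w then w ! b else k - b = 1 \<or> k - b = 3)" if "b \<le> k" for b
    using B[OF that] block_letter_word[OF w that] by simp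
  have M': "matches (\<lambda>j. ?h (a + j)) n m" using M by (simp add: i add.assoc)
  then have ones: "?h a" "?h (Suc a)" "?h (a + m + n + 5)" "?h (a + m + n + 6)"
    by (simp_all add: matches_def ac_simps)
  \<comment> \<open>The initial \<open>11\<close> lies in a legal word. An occurrence that leaves this word contains the following
    filler, whose two isolated ones do not fit between \<open>11\<close> and \<open>11\<close>.\<close>
  have "?ok \<and> a < length w"
  proof (rule ccontr)
    assume not: "\<not> (?ok \<and> a < length w)"
    then have "k - a = 1 \<or> k - a = 3" using h[OF ak] ones(1) by auto
    moreover from this have "Suc a \<le> k" by linarith
    then have "k - Suc a = 1 \<or> k - Suc a = 3"
      using h[of "Suc a"] ones(2) not by (auto split: if_splits)
    ultimately show False by linarith
  qed
  then have ok: ?ok and aw: "a < length w" by auto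
  have tail: "?h b \<longleftrightarrow> b + 1 = k \<or> b + 3 = k" if "b \<le> k" "length w \<le> b" for b
    using h[OF that(1)] that by auto
  show "T n m"
  proof (cases "a + m + n + 7 \<le> length w")
    case True
    have "matches (\<lambda>j. w ! (a + j)) n m \<longleftrightarrow> matches (\<lambda>j. ?h (a + j)) n m"
      using True ok by (intro matches_cong) (subst h, auto)
    then show ?thesis using M' True ok unfolding legal_def by blast
  next
    case False
    \<comment> \<open>Otherwise a closing 1 falls into the filler of this block. If the last 1 does,
      the reserved five letters put its predecessor there too, and filler ones are never adjacent;
      if the block ends just before it, the final letter of the block is 0.\<close>
    have "k < a + m + n + 5"
    proof (rule ccontr)
      assume k: "\<not> k < a + m + n + 5"
      show False
      proof (cases "a + m + n + 6 \<le> k")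
        case True
        have "a + m + n + 7 = k \<or> a + m + n + 9 = k"
          using tail[OF True] ones(4) False by auto
        moreover have "a + m + n + 6 = k \<or> a + m + n + 8 = k"
          using tail[of "a + m + n + 5"] ones(3) k calculation ok False by auto
        ultimately show False by linarith
      next
        case nle: False
        then show False using tail[of "a + m + n + 5"] ones(3) k ok False by auto
      qed
    qed
    \<comment> \<open>The letter right after the word is a 0.\<close>
    moreover have "Suc a < length w"
    proof (rule ccontr)
      assume "\<not> Suc a < length w"
      then show False using tail[of "Suc a"] ones(2) aw ok by auto
    qed
    ultimately have p: "2 \<le> k - 3 - a" "k - 3 - a < m + n + 5" "2 \<le> k - 1 - a" "k - 1 - a < m + n + 5"
      and e: "a + (k - 3 - a) = k - 3" "a + (k - 1 - a) = k - 1"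
      using ok by auto
    have "?h (k - 3)" "?h (k - 1)" using tail[of "k - 3"] tail[of "k - 1"] ok by auto
    then have "k - 3 - a = m + 3" "k - 1 - a = m + 3"
      using matches_inner[OF M' _ p(1,2)] matches_inner[OF M' _ p(3,4)] unfolding e by auto
    then show ?thesis using p by linarith
  qed
qed

section \<open>Factors and recurrence\<close>

lemma length_segment: "length (segment \<xi> i j) = nat (j - i + 1)"
  by (simp add: segment_def)

lemma nth_segment: "k < nat (j - i + 1) \<Longrightarrow> segment \<xi> i j ! k = \<xi> (i + int k)"
  by (simp add: segment_def)

lemma legal_segment: "legal T (segment (block_word T) i j)"
  unfolding legal_def
proof (intro allI impI)
  fix k n m
  assume le: "k + m + n + 7 \<le> length (segment (block_word T) i j)"
    and M: "matches (\<lambda>l. segment (block_word T) i j ! (k + l)) n m"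
  have "matches (\<lambda>l. block_word T (i + int k + int l)) n m"
    using M le unfolding length_segment
    by (subst matches_cong[where h' = "\<lambda>l. segment (block_word T) i j ! (k + l)"])
       (simp_all add: nth_segment add.assoc)
  then show "T n m" by (rule block_word_legal)
qed

lemma legal_occurs:
  assumes "legal T w"
  obtains s t where "i \<le> s" "t + int (length w) \<le> i + 1"
    "\<And>a. a < length w \<Longrightarrow> block_word T (s + int a) = w ! a"
    "\<And>a. a < length w \<Longrightarrow> block_word T (t + int a) = w ! a"
proof -
  \<comment> \<open>The second component of the pair is free. This choice makes \<open>k\<close>
    large enough for the word to fit and for both copies of block \<open>k\<close> to lie on the
    required sides of \<open>i\<close>.\<close>
  let ?b = "nat \<bar>i\<bar> + length w + 4"
  define k where "k = prod_encode (word_code w, ?b)"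
  have k: "?b \<le> k" unfolding k_def by (rule le_prod_encode_2)
  have w: "pfst k = word_code w" by (simp add: k_def)
  have L: "block_letter T a (k - a) = w ! a" if "a < length w" for a
    using block_letter_word[OF w, of a] that k assms by simp
  have "k \<le> triangle k" by (induction k) auto
  show ?thesis
  proof (rule that)
    show "i \<le> int (triangle k)"
      using \<open>k \<le> triangle k\<close> k by linarith
    show "- int (triangle k + k) - 1 + int (length w) \<le> i + 1"
      using k \<open>k \<le> triangle k\<close> by linarith
  qed (use k in \<open>simp_all only: L block_word_right block_word_left\<close>)
qed

lemma factors_on_block_word:
  assumes "\<And>w. legal T w \<Longrightarrow> \<exists>s. {s..s + int (length w) - 1} \<subseteq> I \<and>
    (\<forall>a < length w. block_word T (s + int a) = w ! a)"
  shows "factors_on (block_word T) I = {w. legal T w}"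
proof (intro equalityI subsetI)
  fix w assume "w \<in> factors_on (block_word T) I"
  then show "w \<in> {w. legal T w}" by (auto simp: factors_on_def legal_segment) (simp add: legal_def)
next
  fix w assume "w \<in> {w. legal T w}"
  then obtain s where s: "{s..s + int (length w) - 1} \<subseteq> I"
    "\<And>a. a < length w \<Longrightarrow> block_word T (s + int a) = w ! a" using assms by blast
  have "w = segment (block_word T) s (s + int (length w) - 1)"
    by (rule nth_equalityI) (simp_all add: length_segment nth_segment s(2))
  moreover have "s \<le> s + int (length w) - 1" if "w \<noteq> []" using that by (cases w) auto
  ultimately show "w \<in> factors_on (block_word T) I" using s(1) unfolding factors_on_def by blast
qed

lemma factors_on_right: "factors_on (block_word T) {i..} = {w. legal T w}"
proof (rule factors_on_block_word)
  fix w assume "legal T w"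
  then obtain s where "i \<le> s" "\<And>a. a < length w \<Longrightarrow> block_word T (s + int a) = w ! a"
    by (rule legal_occurs[of T w i]) blast
  then show "\<exists>s. {s..s + int (length w) - 1} \<subseteq> {i..} \<and> (\<forall>a < length w. block_word T (s + int a) = w ! a)"
    by (intro exI[of _ s]) auto
qed

lemma factors_on_left: "factors_on (block_word T) {..i} = {w. legal T w}"
proof (rule factors_on_block_word)
  fix w assume "legal T w"
  then obtain t where "t + int (length w) \<le> i + 1" "\<And>a. a < length w \<Longrightarrow> block_word T (t + int a) = w ! a"
    by (rule legal_occurs[of T w i]) blast
  then show "\<exists>s. {s..s + int (length w) - 1} \<subseteq> {..i} \<and> (\<forall>a < length w. block_word T (s + int a) = w ! a)"
    by (intro exI[of _ t]) auto
qed

lemma factors_block_word: "factors (block_word T) = {w. legal T w}"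
proof (rule factors_on_block_word)
  fix w assume "legal T w"
  then obtain s where "\<And>a. a < length w \<Longrightarrow> block_word T (s + int a) = w ! a"
    by (rule legal_occurs[of T w 0]) blast
  then show "\<exists>s. {s..s + int (length w) - 1} \<subseteq> UNIV \<and> (\<forall>a < length w. block_word T (s + int a) = w ! a)"
    by blast
qed

lemma recurrent_block_word: "recurrent (block_word T)"
  by (simp add: recurrent_def factors_block_word factors_on_left factors_on_right)

section \<open>Effectiveness of the word and of its factors\<close>

lemma decidable_legal_code:
  assumes "decidable (\<lambda>p. T (pfst p) (psnd p))"
  shows "decidable (legal_code T)"
proof -
  note [comp] = decidable_comp2[of T, OF assms]
  show ?thesis unfolding legal_code_def[abs_def] matches_def by (intro comp)
qed

lemma decidable_language_block_word:
  assumes "decidable (\<lambda>p. T (pfst p) (psnd p))"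
  shows "decidable_language (factors (block_word T))"
proof -
  have "c \<in> word_code ` {w. legal T w} \<longleftrightarrow> legal_code T c" for c
  proof -
    obtain w where "c = word_code w" using bij_word_code by (metis bij_pointE)
    then show ?thesis using bij_word_code by (auto simp: bij_is_inj inj_image_mem_iff)
  qed
  then show ?thesis
    using decidable_legal_code[OF assms]
    by (simp add: decidable_language_def recursive_set_iff_decidable factors_block_word)
qed

lemma recursive_block_word:
  assumes "decidable (\<lambda>p. T (pfst p) (psnd p))"
  shows "recursive_word (block_word T)"
proof -
  note [comp] = decidable_comp[OF decidable_legal_code[OF assms]]
  have "decidable (\<lambda>p. block_letter T (pfst p) (psnd p))"
    unfolding block_letter_def by (intro comp)
  note [comp] = decidable_comp2[of "block_letter T", OF this]
  \<comment> \<open>An odd number \<open>2 * i + 1\<close> stands for position \<open>-i\<close>,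
    which is entry \<open>i - 1\<close> of the enumeration with exchanged coordinates;
    \<open>0 < n div 2\<close> excludes \<open>i = 0\<close>.\<close>
  have "decidable (\<lambda>n. if odd n then 0 < n div 2 \<and>
      block_letter T (psnd (n div 2 - 1)) (pfst (n div 2 - 1))
    else block_letter T (pfst (n div 2)) (psnd (n div 2)))"
    by (intro comp)
  moreover have "n \<in> {2 * i | i. block_word T (int i)} \<union> {2 * i + 1 | i. i > 0 \<and> block_word T (- int i)} \<longleftrightarrow>
    (if odd n then 0 < n div 2 \<and> block_letter T (psnd (n div 2 - 1)) (pfst (n div 2 - 1))
     else block_letter T (pfst (n div 2)) (psnd (n div 2)))" for n
  proof (cases "odd n")
    case True
    then obtain i where n: "n = 2 * i + 1" by (elim oddE)
    have "nat (int i - 1) = i - 1" "\<And>j. Suc (2 * i) \<noteq> 2 * j" by (linarith, presburger)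
    then show ?thesis by (auto simp: n block_word_def)
  next
    case False
    then obtain i where n: "n = 2 * i" by auto
    have "\<And>j. 2 * i \<noteq> Suc (2 * j)" by presburger
    then show ?thesis by (auto simp: n block_word_def)
  qed
  ultimately show ?thesis
    unfolding recursive_word_def recursive_set_iff_decidable by (simp only:)
qed

lemma block_word_matches:
  "(\<exists>i. matches (\<lambda>j. block_word T (i + int j)) n m) \<longleftrightarrow> T n m"
proof
  assume "T n m"
  define h where "h j \<longleftrightarrow> j \<in> {0, 1, m + 3, m + n + 5, m + n + 6}" for j
  define w where "w = map h [0..<m + n + 7]"
  have [simp]: "length w = m + n + 7" "\<And>j. j < m + n + 7 \<Longrightarrow> w ! j = h j"
    by (simp_all add: w_def)
  have "legal T w"
    unfolding legal_def
  proof (intro allI impI)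
    fix i n' m' assume le: "i + m' + n' + 7 \<le> length w" and M: "matches (\<lambda>j. w ! (i + j)) n' m'"
    have M: "matches (\<lambda>j. h (i + j)) n' m'"
      using M le by (subst matches_cong[where h' = "\<lambda>j. w ! (i + j)"]) simp_all
    then have "h i" "h (i + 1)" "h (i + (m' + 3))" "h (i + (m' + n' + 5))"
      by (simp_all add: matches_def)
    \<comment> \<open>Inside the pattern word, adjacent ones occur only at its two ends. The length
      bound forces the opening pair to the left end, and the remaining ones then fix both
      parameters.\<close>
    then have "i = 0" "m' = m" "n' = n" using le by (auto simp: h_def)
    then show "T n' m'" using \<open>T n m\<close> by simp
  qed
  then obtain s where "\<And>a. a < length w \<Longrightarrow> block_word T (s + int a) = w ! a"
    by (rule legal_occurs[where i = 0]) blast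
  then have "matches (\<lambda>j. block_word T (s + int j)) n m \<longleftrightarrow> matches h n m"
    by (intro matches_cong) simp
  moreover have "matches h n m" by (simp add: matches_def h_def)
  ultimately show "\<exists>i. matches (\<lambda>j. block_word T (i + int j)) n m" by blast
qed (blast intro: block_word_legal)

section \<open>The pattern sentences\<close>

definition And :: "mso \<Rightarrow> mso \<Rightarrow> mso" where
  "And \<phi> \<psi> = Neg (Disj (Neg \<phi>) (Neg \<psi>))"

definition Less :: "nat \<Rightarrow> nat \<Rightarrow> mso" where
  "Less x y = And (LessEq x y) (Neg (Equal x y))"

text \<open>\<open>Suc (x + y)\<close> is a variable different from both \<open>x\<close> and
  \<open>y\<close>, so its quantifier captures neither.\<close>

definition Next :: "nat \<Rightarrow> nat \<Rightarrow> mso" where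
  "Next x y = And (Less x y) (Neg (ExElt (Suc (x + y)) (And (Less x (Suc (x + y))) (Less (Suc (x + y)) y))))"

lemma free_And [simp]: "free_elts (And \<phi> \<psi>) = free_elts \<phi> \<union> free_elts \<psi>"
    "free_sets (And \<phi> \<psi>) = free_sets \<phi> \<union> free_sets \<psi>"
  by (simp_all add: And_def)

lemma free_Less [simp]: "free_elts (Less x y) = {x, y}" "free_sets (Less x y) = {}"
  by (auto simp: Less_def)

lemma free_Next [simp]: "free_elts (Next x y) = {x, y}" "free_sets (Next x y) = {}"
  by (auto simp: Next_def)

lemma sat_And [simp]: "sat le P s S (And \<phi> \<psi>) \<longleftrightarrow> sat le P s S \<phi> \<and> sat le P s S \<psi>"
  by (simp add: And_def)

lemma sat_Less [simp]: "sat (\<le>) P s S (Less x y) \<longleftrightarrow> s x < (s y :: 'a :: order)"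
  by (auto simp: Less_def)

lemma sat_Next [simp]: "sat (\<le>) P s S (Next x y) \<longleftrightarrow> (s y :: int) = s x + 1"
proof -
  have "(a < b \<and> (\<forall>c. a < c \<longrightarrow> \<not> c < b)) \<longleftrightarrow> b = a + 1" for a b :: int
  proof
    assume *: "a < b \<and> (\<forall>c. a < c \<longrightarrow> \<not> c < b)"
    then have "\<not> a + 1 < b" by (metis less_add_one)
    with * show "b = a + 1" by linarith
  qed auto
  then show ?thesis by (simp add: Next_def)
qed

text \<open>\<open>run n\<close> says that element variable 0 is followed by \<open>0\<^sup>n 1 1\<close>. Only the variables 0 and 1 are used,
  so that the code of \<open>run n\<close> is computed by a simple recursion on \<open>n\<close>.\<close>

fun run :: "nat \<Rightarrow> mso" where
  "run 0 = ExElt 1 (And (Next 0 1) (And (Label 1) (ExElt 0 (And (Next 1 0) (Label 0)))))"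
| "run (Suc n) = ExElt 1 (And (Next 0 1) (And (Neg (Label 1)) (ExElt 0 (And (Equal 0 1) (run n)))))"

lemma free_run: "free_elts (run n) \<subseteq> {0}" "free_sets (run n) = {}"
  by (induction n) auto

text \<open>In the step case, requantifying variable 0 and equating it with variable 1 moves the
  reference position one place to the right, where the induction hypothesis applies.\<close>

lemma sat_run: "sat (\<le>) P s S (run n) \<longleftrightarrow>
  (\<forall>j<n. s 0 + 1 + int j \<notin> P) \<and> s 0 + 1 + int n \<in> P \<and> s 0 + 2 + int n \<in> P"
proof (induction n arbitrary: s)
  case (Suc n)
  show ?case by (simp add: Suc.IH All_less_Suc2 add.assoc)
qed (simp add: add.commute)

text \<open>Variables 2 and 3 mark the opening \<open>11\<close>, variable 0 the inner 1. Their gap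
  stays free apart from being nonempty and filled with zeros, so \<open>m\<close> is quantified
  implicitly; \<open>n\<close> is spelled out by \<open>run\<close>.\<close>

definition pattern_sentence :: "nat \<Rightarrow> mso" where
  "pattern_sentence n = ExElt 2 (And (Label 2) (ExElt 3 (And (Next 2 3) (And (Label 3)
     (ExElt 0 (And (And (Less 3 0) (And (Neg (Next 3 0)) (Label 0)))
       (And (Neg (ExElt 1 (And (And (Less 3 1) (Less 1 0)) (Label 1)))) (run (Suc n)))))))))"

lemma sentence_pattern_sentence: "sentence (pattern_sentence n)"
  using free_run[of "Suc n"] by (auto simp: sentence_def pattern_sentence_def simp del: run.simps)

lemma sat_pattern_sentence:
  "sat (\<le>) {i. \<xi> i} s S (pattern_sentence n) \<longleftrightarrow> (\<exists>m i. matches (\<lambda>j. \<xi> (i + int j)) n m)"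
proof -
  have "sat (\<le>) {i. \<xi> i} s S (pattern_sentence n) \<longleftrightarrow>
    (\<exists>x. \<xi> x \<and> \<xi> (x + 1) \<and> (\<exists>y. x + 1 < y \<and> y \<noteq> x + 1 + 1 \<and> \<xi> y \<and>
       (\<forall>z. z < y \<longrightarrow> x + 1 < z \<longrightarrow> \<not> \<xi> z) \<and>
       (\<forall>j < Suc n. \<not> \<xi> (y + 1 + int j)) \<and> \<xi> (y + 1 + int (Suc n)) \<and> \<xi> (y + 2 + int (Suc n))))"
    (is "_ \<longleftrightarrow> (\<exists>x. ?R x)")
    by (simp add: pattern_sentence_def sat_run del: run.simps)
  moreover have "?R x \<longleftrightarrow> (\<exists>m. matches (\<lambda>j. \<xi> (x + int j)) n m)" for x
  proof
    assume "?R x"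
    then obtain y where y: "x + 1 < y" "y \<noteq> x + 1 + 1" "\<xi> y" "\<forall>z. z < y \<longrightarrow> x + 1 < z \<longrightarrow> \<not> \<xi> z"
      "\<forall>j < Suc n. \<not> \<xi> (y + 1 + int j)" "\<xi> (y + 1 + int (Suc n))" "\<xi> (y + 2 + int (Suc n))"
      and x: "\<xi> x" "\<xi> (x + 1)" by blast
    \<comment> \<open>The inner 1 has offset \<open>m + 3\<close> in the pattern.\<close>
    define m where "m = nat (y - x - 3)"
    have "y = x + int m + 3" using y(1,2) by (simp add: m_def)
    with x y(3-) have "matches (\<lambda>j. \<xi> (x + int j)) n m"
      by (simp add: matches_def ac_simps)
    then show "\<exists>m. matches (\<lambda>j. \<xi> (x + int j)) n m" by blast
  next
    assume "\<exists>m. matches (\<lambda>j. \<xi> (x + int j)) n m"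
    then obtain m where m: "matches (\<lambda>j. \<xi> (x + int j)) n m" by blast
    have "\<not> \<xi> z" if "x + 1 < z" "z < x + int m + 3" for z
    proof -
      have j: "nat (z - x - 2) < Suc m" and z: "z = x + int (nat (z - x - 2) + 2)" using that by auto
      have "\<forall>j < Suc m. \<not> \<xi> (x + int (j + 2))" using m unfolding matches_def by (elim conjE)
      then show ?thesis using j by (subst z) blast
    qed
    moreover have "\<xi> x" "\<xi> (x + 1)" "\<xi> (x + int m + 3)" "\<xi> (x + int m + 3 + 1 + int (Suc n))"
      "\<xi> (x + int m + 3 + 2 + int (Suc n))" "\<forall>j < Suc n. \<not> \<xi> (x + int m + 3 + 1 + int j)"
      using m by (simp_all add: matches_def ac_simps)
    ultimately show "?R x"
      by (intro conjI exI[of _ "x + int m + 3"] allI impI) simp_all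
  qed
  ultimately show ?thesis by blast
qed

lemma computable_code_run [comp]:
  assumes "computable A" shows "computable (\<lambda>n. mso_code (run (A n)))"
proof -
  let ?And = "\<lambda>a b. prod_encode (4, prod_encode (5, prod_encode (prod_encode (4, a), prod_encode (4, b))))"
  let ?H = "\<lambda>c. prod_encode (6, prod_encode (1, ?And (mso_code (Next 0 1))
    (?And (mso_code (Neg (Label 1))) (prod_encode (6, prod_encode (0, ?And (mso_code (Equal 0 1)) c))))))"
  have "computable (\<lambda>n. rec_nat (mso_code (run 0)) (\<lambda>_ c. ?H c) (A n))" by (intro comp assms)
  moreover have "rec_nat (mso_code (run 0)) (\<lambda>_ c. ?H c) k = mso_code (run k)" for k
    by (induction k) (simp_all add: And_def)
  ultimately show ?thesis by simp
qed

lemma computable_code_pattern_sentence: "computable (\<lambda>n. mso_code (pattern_sentence n))"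
  unfolding pattern_sentence_def And_def mso_code.simps by (intro comp)

theorem theorem5p3:
  "\<exists>\<xi> :: biword. recurrent \<xi> \<and> recursive_word \<xi> \<and>
     decidable_language (factors \<xi>) \<and> \<not> decidable_theory (MTh \<xi>)"
proof -
  obtain T where T: "decidable (\<lambda>p. T (pfst p) (psnd p))" "\<not> decidable (\<lambda>n. \<exists>m. T n m)"
    by (rule undecidable_projection)
  let ?\<xi> = "block_word T"
  \<comment> \<open>The sentence codes give a computable many-one reduction of the undecidable
    projection to the theory.\<close>
  have "mso_code (pattern_sentence n) \<in> mso_code ` MTh ?\<xi> \<longleftrightarrow> (\<exists>m. T n m)" for n
    using block_word_matches[of T n] inj_mso_code
    by (auto simp: inj_image_mem_iff MTh_def sentence_pattern_sentence sat_pattern_sentence)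
  then have "\<not> decidable_theory (MTh ?\<xi>)"
    using decidable_comp[of "\<lambda>c. c \<in> mso_code ` MTh ?\<xi>", OF _ computable_code_pattern_sentence] T(2)
    by (auto simp only: decidable_theory_def recursive_set_iff_decidable)
  then show ?thesis
    using recurrent_block_word recursive_block_word[OF T(1)] decidable_language_block_word[OF T(1)]
    by blast
qed

end
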